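(* Let $\mathbf{k}$ be an infinite field, let $n\ge 2$, and let $A=\{a_1=0,a_2,\dots,a_n\}$ be a set of integers with $0=a_1<a_2<\cdots<a_n$ and $\gcd(a_2,\dots,a_n)=1$. Let $\phi:\mathbf{k}[X_1,\dots,X_n]\to\mathbf{k}[t,w]$ be the $\mathbf{k}$-algebra morphism with $\phi(X_i)=t^{a_i}w$, and let $I_A=\ker(\psi)$, where $\psi:\mathbf{k}[X_1,\dots,X_n]\to\mathbf{k}[u,v]$ is the $\mathbf{k}$-algebra morphism with $\psi(X_i)=u^{a_n-a_i}v^{a_i}$. Then $\ker(\phi)=I_A$. Hence $R(A)\cong\mathbf{k}[C_A]$ as graded $\mathbf{k}$-algebras.
   Context: $R(A)$ is the $\mathbf{k}$-subalgebra of $\mathbf{k}[t,w]$ generated by $t^{a_i}w$, $i=1,\dots,n$ (the image of $\phi$), graded via $\deg(t)=0$, $\deg(w)=1$. $C_A\subset\mathbb{P}^{n-1}_{\mathbf{k}}$ is the monomial projective curve defined by the homogeneous ideal $I_A$, and $\mathbf{k}[C_A]=\mathbf{k}[X_1,\dots,X_n]/I_A$ is its homogeneous coordinate ring, with the standard grading $\deg X_i=1$. *)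

theory Defs
  imports "HOL-Algebra.Algebra" "HOL-Library.Poly_Mapping"
begin

section \<open>Graded algebras\<close>

text \<open>
  Algebras are records of type \<open>module\<close> satisfying the locale \<open>algebra\<close> of \<open>HOL-Algebra\<close>
  (commutative, unital). A grading is a family of submodules indexed by the natural numbers.
\<close>

definition alg_hom ::
  "('c, 'r) ring_scheme \<Rightarrow> ('c, 'a, 'm) module_scheme \<Rightarrow> ('c, 'b, 'q) module_scheme \<Rightarrow> ('a \<Rightarrow> 'b) set"
where
  "alg_hom K M N =
     {h \<in> ring_hom M N. \<forall>c\<in>carrier K. \<forall>x\<in>carrier M. h (c \<odot>\<^bsub>M\<^esub> x) = c \<odot>\<^bsub>N\<^esub> h x}"

definition subalg :: "('c, 'r) ring_scheme \<Rightarrow> ('c, 'a, 'm) module_scheme \<Rightarrow> 'a set \<Rightarrow> bool" where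
  "subalg K M H \<longleftrightarrow> submodule H K M \<and> subring H M"

definition generated_alg ::
  "('c, 'r) ring_scheme \<Rightarrow> ('c, 'a, 'm) module_scheme \<Rightarrow> 'a set \<Rightarrow> ('c, 'a, 'm) module_scheme"
where
  "generated_alg K M S = M\<lparr>carrier := \<Inter>{H. subalg K M H \<and> S \<subseteq> H}\<rparr>"

text \<open>
  The ring part is the library quotient; the scalar action on cosets is
  \<open>c \<odot> (I + p) = I + c \<odot> p\<close>, written representative-free as the library does for
  \<^const>\<open>rcoset_mult\<close>.
\<close>

definition quotient_alg ::
  "('c, 'a, 'm) module_scheme \<Rightarrow> 'a set \<Rightarrow> ('c, 'a set) module"
where
  "quotient_alg M I =
     \<lparr>carrier = carrier (M Quot I), monoid.mult = monoid.mult (M Quot I), one = one (M Quot I),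
      ring.zero = ring.zero (M Quot I), add = add (M Quot I),
      smult = (\<lambda>c S. \<Union>x\<in>S. I +>\<^bsub>M\<^esub> (c \<odot>\<^bsub>M\<^esub> x))\<rparr>"

definition graded_algebra ::
  "('c, 'r) ring_scheme \<Rightarrow> ('c, 'a, 'm) module_scheme \<Rightarrow> (nat \<Rightarrow> 'a set) \<Rightarrow> bool"
where
  "graded_algebra K M G \<longleftrightarrow>
     algebra K M \<and>
     (\<forall>d. submodule (G d) K M) \<and>
     (\<forall>x\<in>carrier M. \<exists>!y. (\<forall>d. y d \<in> G d) \<and> finite {d. y d \<noteq> \<zero>\<^bsub>M\<^esub>} \<and>
                         x = (\<Oplus>\<^bsub>M\<^esub>d\<in>{d. y d \<noteq> \<zero>\<^bsub>M\<^esub>}. y d)) \<and>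
     (\<forall>d e. \<forall>x\<in>G d. \<forall>y\<in>G e. x \<otimes>\<^bsub>M\<^esub> y \<in> G (d + e))"

definition graded_alg_isomorphic ::
  "('c, 'r) ring_scheme \<Rightarrow> ('c, 'a, 'm) module_scheme \<Rightarrow> (nat \<Rightarrow> 'a set)
     \<Rightarrow> ('c, 'b, 'q) module_scheme \<Rightarrow> (nat \<Rightarrow> 'b set) \<Rightarrow> bool"
where
  "graded_alg_isomorphic K M G N H \<longleftrightarrow>
     graded_algebra K M G \<and> graded_algebra K N H \<and>
     (\<exists>h \<in> alg_hom K M N. bij_betw h (carrier M) (carrier N) \<and> (\<forall>d. h ` G d = H d))"


section \<open>Polynomial algebras\<close>

text \<open>
  Polynomials with coefficients in \<open>'k\<close> and variables in \<open>'v\<close> are finitely supported functions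
  from exponent vectors to coefficients, with the convolution product of
  \<^theory>\<open>HOL-Library.Poly_Mapping\<close>.
\<close>

type_synonym ('v, 'k) mpoly = "('v \<Rightarrow>\<^sub>0 nat) \<Rightarrow>\<^sub>0 'k"

definition mvar :: "'v \<Rightarrow> ('v, 'k::comm_ring_1) mpoly" where
  "mvar v = Poly_Mapping.single (Poly_Mapping.single v 1) 1"

definition mconst :: "'k \<Rightarrow> ('v, 'k::comm_ring_1) mpoly" where
  "mconst c = Poly_Mapping.single 0 c"

definition base_field :: "'k::field ring" where
  "base_field = \<lparr>carrier = UNIV, monoid.mult = (*), one = 1, ring.zero = 0, add = (+)\<rparr>"

text \<open>The polynomial algebra \<open>'k[V]\<close> in the variables belonging to \<open>V\<close> only.\<close>

definition mpoly_alg :: "'v set \<Rightarrow> ('k::field, ('v, 'k) mpoly) module" where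
  "mpoly_alg V =
     \<lparr>carrier = {p. \<forall>m\<in>Poly_Mapping.keys p. Poly_Mapping.keys m \<subseteq> V},
      monoid.mult = (*), one = 1, ring.zero = 0, add = (+), smult = (\<lambda>c p. mconst c * p)\<rparr>"

text \<open>Polynomials (including 0) homogeneous of degree \<open>d\<close>, where the variable \<open>v\<close> has degree \<open>\<omega> v\<close>.\<close>

definition homogeneous :: "('v \<Rightarrow> nat) \<Rightarrow> nat \<Rightarrow> ('v, 'k::zero) mpoly set" where
  "homogeneous \<omega> d =
     {p. \<forall>m\<in>Poly_Mapping.keys p.
           (\<Sum>v\<in>Poly_Mapping.keys m. Poly_Mapping.lookup m v * \<omega> v) = d}"


lemma base_field_cring: "cring (base_field :: 'k::field ring)"
proof -
  have "\<exists>y. x + y = 0" for x :: 'k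
    using add.right_inverse by blast
  thus ?thesis
    unfolding base_field_def using add.right_inverse
    by unfold_locales (auto simp: algebra_simps Units_def)
qed

lemma mconst_add: "mconst (c + d) = mconst c + mconst d"
  by (simp add: mconst_def single_add)

lemma mconst_mult: "mconst (c * d) = mconst c * mconst d"
  by (simp add: mconst_def mult_single)

lemma mconst_zero: "mconst 0 = 0"
  by (simp add: mconst_def)

lemma mconst_one: "mconst 1 = 1"
  by (simp add: mconst_def)

lemma mpoly_alg_algebra: "algebra base_field (mpoly_alg V :: ('k::field, ('v, 'k) mpoly) module)"
proof -
  define C where "C = {p :: ('v, 'k) mpoly. \<forall>m\<in>Poly_Mapping.keys p. Poly_Mapping.keys m \<subseteq> V}"
  have M: "mpoly_alg V = \<lparr>carrier = C, monoid.mult = (*), one = 1, ring.zero = 0, add = (+),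
                            smult = (\<lambda>c p. mconst c * p)\<rparr>"
    by (simp add: mpoly_alg_def C_def)
  have add: "p + q \<in> C" if "p \<in> C" "q \<in> C" for p q
    using that Poly_Mapping.keys_add[of p q] unfolding C_def by blast
  have mult: "p * q \<in> C" if "p \<in> C" "q \<in> C" for p q
  proof -
    have "Poly_Mapping.keys m \<subseteq> V" if mpq: "m \<in> Poly_Mapping.keys (p * q)" for m
    proof -
      obtain m1 m2 where m: "m = m1 + m2" "m1 \<in> Poly_Mapping.keys p" "m2 \<in> Poly_Mapping.keys q"
        using Poly_Mapping.keys_mult[of p q] mpq by blast
      thus ?thesis
        using \<open>p \<in> C\<close> \<open>q \<in> C\<close> Poly_Mapping.keys_add[of m1 m2] unfolding C_def by blast
    qed
    thus ?thesis unfolding C_def by blast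
  qed
  have const: "mconst c \<in> C" for c
    by (auto simp: mconst_def C_def)
  have zero: "0 \<in> C" and one: "1 \<in> C"
    by (auto simp: C_def)
  have neg: "\<exists>q\<in>C. q + p = 0 \<and> p + q = 0" if "p \<in> C" for p
    using that by (intro bexI[of _ "- p"]) (auto simp: C_def)
  have cring: "cring (mpoly_alg V :: ('k, ('v, 'k) mpoly) module)"
  proof (rule cringI)
    show "abelian_group (mpoly_alg V :: ('k, ('v, 'k) mpoly) module)"
    proof (rule abelian_groupI)
      fix x assume "x \<in> carrier (mpoly_alg V :: ('k, ('v, 'k) mpoly) module)"
      then show "\<exists>y\<in>carrier (mpoly_alg V). y \<oplus>\<^bsub>mpoly_alg V\<^esub> x = \<zero>\<^bsub>mpoly_alg V\<^esub>"
        using neg[of x] by (auto simp: M)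
    qed (simp_all add: M add zero ac_simps)
    show "Group.comm_monoid (mpoly_alg V :: ('k, ('v, 'k) mpoly) module)"
      by (rule comm_monoidI) (simp_all add: M mult one ac_simps)
  qed (simp add: M distrib_right)
  show ?thesis
  proof (rule algebraI[OF base_field_cring cring], goal_cases)
    case (1 c p)
    then show ?case using mult[OF const, of p c] by (simp add: M)
  qed (simp_all add: M base_field_def mconst_add mconst_mult mconst_one
                     distrib_left distrib_right mult.assoc)
qed

text \<open>Existence of the algebra morphism with prescribed values on the variables.\<close>

definition monomial_value ::
  "('v \<Rightarrow> ('w, 'k::field) mpoly) \<Rightarrow> ('v \<Rightarrow>\<^sub>0 nat) \<Rightarrow> ('w, 'k) mpoly"
where
  "monomial_value b m = (\<Prod>v\<in>Poly_Mapping.keys m. b v ^ Poly_Mapping.lookup m v)"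

definition substitute ::
  "('v \<Rightarrow> ('w, 'k::field) mpoly) \<Rightarrow> ('v, 'k) mpoly \<Rightarrow> ('w, 'k) mpoly"
where
  "substitute b p =
     (\<Sum>m\<in>Poly_Mapping.keys p. mconst (Poly_Mapping.lookup p m) * monomial_value b m)"

lemma monomial_value_add: "monomial_value b (m + m') = monomial_value b m * monomial_value b m'"
proof -
  let ?S = "Poly_Mapping.keys m \<union> Poly_Mapping.keys m'"
  have *: "monomial_value b k = (\<Prod>v\<in>?S. b v ^ Poly_Mapping.lookup k v)"
    if "Poly_Mapping.keys k \<subseteq> ?S" for k
    unfolding monomial_value_def using that
    by (intro prod.mono_neutral_left) (auto simp: in_keys_iff)
  show ?thesis
    using Poly_Mapping.keys_add[of m m']
    by (simp add: * lookup_add power_add prod.distrib)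
qed

lemma substitute_single: "substitute b (Poly_Mapping.single m c) = mconst c * monomial_value b m"
  by (auto simp: substitute_def mconst_def)

lemma substitute_add: "substitute b (p + q) = substitute b p + substitute b q"
proof -
  let ?S = "Poly_Mapping.keys p \<union> Poly_Mapping.keys q"
  have *: "substitute b r = (\<Sum>m\<in>?S. mconst (Poly_Mapping.lookup r m) * monomial_value b m)"
    if "Poly_Mapping.keys r \<subseteq> ?S" for r
    unfolding substitute_def using that
    by (intro sum.mono_neutral_left) (auto simp: in_keys_iff mconst_def)
  show ?thesis
    using Poly_Mapping.keys_add[of p q]
    by (simp add: * lookup_add mconst_add sum.distrib distrib_right)
qed

lemma substitute_sum: "substitute b (sum f S) = (\<Sum>x\<in>S. substitute b (f x))"
  by (induction S rule: infinite_finite_induct)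
     (simp_all add: substitute_add, simp_all add: substitute_def)

lemma mpoly_sum_monomials:
  "(\<Sum>m\<in>Poly_Mapping.keys p. Poly_Mapping.single m (Poly_Mapping.lookup p m)) = p"
  by (rule poly_mapping_eqI)
     (auto simp: lookup_sum lookup_single when_def in_keys_iff)

lemma substitute_mult: "substitute b (p * q) = substitute b p * substitute b q"
proof -
  have "p * q = (\<Sum>m\<in>Poly_Mapping.keys p. \<Sum>m'\<in>Poly_Mapping.keys q.
          Poly_Mapping.single (m + m') (Poly_Mapping.lookup p m * Poly_Mapping.lookup q m'))"
    by (simp add: mpoly_sum_monomials flip: sum_product mult_single)
  hence "substitute b (p * q) = (\<Sum>m\<in>Poly_Mapping.keys p. \<Sum>m'\<in>Poly_Mapping.keys q.
           mconst (Poly_Mapping.lookup p m * Poly_Mapping.lookup q m') * monomial_value b (m + m'))"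
    by (simp only: substitute_sum substitute_single)
  also have "\<dots> = substitute b p * substitute b q"
    unfolding substitute_def sum_product
    by (intro sum.cong refl)
       (simp add: monomial_value_add mconst_mult mult_ac)
  finally show ?thesis .
qed

lemma substitute_alg_hom: "substitute b \<in> alg_hom base_field (mpoly_alg V) (mpoly_alg UNIV)"
proof -
  have const: "substitute b (mconst c) = mconst c" for c
    by (simp add: mconst_def substitute_single monomial_value_def)
  have "substitute b 1 = 1"
    using const[of 1] by (simp add: mconst_one)
  then show ?thesis
    by (auto simp: alg_hom_def ring_hom_def mpoly_alg_def substitute_add substitute_mult const)
qed

lemma substitute_mvar: "substitute b (mvar v) = b v"
  by (simp add: mvar_def substitute_single monomial_value_def mconst_def)


section \<open>The two rings attached to a set of exponents\<close>

datatype tw_var = T | W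
datatype uv_var = U | V

definition deg_tw :: "tw_var \<Rightarrow> nat" where
  "deg_tw x = (case x of T \<Rightarrow> 0 | W \<Rightarrow> 1)"

definition R_A :: "nat \<Rightarrow> (nat \<Rightarrow> int) \<Rightarrow> ('k::field, (tw_var, 'k) mpoly) module" where
  "R_A n a = generated_alg base_field (mpoly_alg UNIV)
               ((\<lambda>i. mvar T ^ nat (a i) * mvar W) ` {1..n})"

definition R_A_component :: "nat \<Rightarrow> (nat \<Rightarrow> int) \<Rightarrow> nat \<Rightarrow> (tw_var, 'k::field) mpoly set" where
  "R_A_component n a d = carrier (R_A n a) \<inter> homogeneous deg_tw d"

text \<open>
  The homogeneous coordinate ring \<open>'k[X\<^sub>1, \<dots>, X\<^sub>n] / I\<close> attached to
  a homogeneous ideal \<open>I\<close>; its degree \<open>d\<close> part consists of the classes of the forms of degree \<open>d\<close>.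
\<close>

definition coord_ring ::
  "nat \<Rightarrow> (nat, 'k::field) mpoly set \<Rightarrow> ('k, (nat, 'k) mpoly set) module"
where
  "coord_ring n I = quotient_alg (mpoly_alg {1..n}) I"

definition coord_ring_component ::
  "nat \<Rightarrow> (nat, 'k::field) mpoly set \<Rightarrow> nat \<Rightarrow> (nat, 'k) mpoly set set"
where
  "coord_ring_component n I d =
     (\<lambda>p. I +>\<^bsub>mpoly_alg {1..n}\<^esub> p) `
       (carrier (mpoly_alg {1..n}) \<inter> homogeneous (\<lambda>_. 1) d)"

end

theory Submission
  imports Defs
begin

text \<open>
  Let \<open>s(m) = \<Sum> m\<^sub>i a\<^sub>i\<close> and let \<open>d(m) = \<Sum> m\<^sub>i\<close>. Then \<open>\<phi>\<close> and \<open>\<psi>\<close> send the monomial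
  \<open>X\<^sup>m\<close> to \<open>t\<^sup>s w\<^sup>d\<close> and to \<open>u\<^sup>r v\<^sup>s\<close> with \<open>r = a\<^sub>n d - s\<close>. As \<open>a\<^sub>n > 0\<close>, the pairs \<open>(s, d)\<close> and
  \<open>(r, s)\<close> determine each other, so \<open>\<phi>\<close> and \<open>\<psi>\<close> identify the same monomials and have the same kernel.
  The isomorphism sends an element of \<open>R(A)\<close>, which is the image of \<open>\<phi>\<close>, to its fibre under \<open>\<phi>\<close>.
  Since \<open>\<phi>\<close> commutes with taking homogeneous components, \<open>R(A)\<close> is a graded subalgebra of \<open>k[t,w]\<close>
  and its grading is carried to that of the coordinate ring.
\<close>

section \<open>Algebras and graded algebras\<close>

lemma alg_homD:
  assumes "h \<in> alg_hom K M N"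
  shows "h \<in> ring_hom M N"
    and "\<And>c x. c \<in> carrier K \<Longrightarrow> x \<in> carrier M \<Longrightarrow> h (c \<odot>\<^bsub>M\<^esub> x) = c \<odot>\<^bsub>N\<^esub> h x"
  using assms by (auto simp: alg_hom_def)

lemma alg_hom_ring_hom_cring:
  assumes "algebra K M" "algebra K N" "h \<in> alg_hom K M N"
  shows "ring_hom_cring M N h"
  using assms by (auto simp: ring_hom_cring_def ring_hom_cring_axioms_def alg_hom_def intro: algebra.M_cring)

lemma submodule_carrier:
  assumes "submodule H K M"
  shows "H \<subseteq> carrier M"
  using subgroup.subset[OF submodule.axioms(1)[OF assms]] by simp

lemma subalg_algebra:
  assumes "algebra K M" "subalg K M H"
  shows "algebra K (M\<lparr>carrier := H\<rparr>)"
proof -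
  interpret M: algebra K M by fact
  have H: "submodule H K M" "subring H M"
    using assms by (auto simp: subalg_def)
  have "cring (M\<lparr>carrier := H\<rparr>)"
    using M.subcring_iff M.subcringI'[OF H(2)] submodule_carrier[OF H(1)] by blast
  moreover have "module K (M\<lparr>carrier := H\<rparr>)"
    using submodule.submodule_is_module[OF H(1) M.module] .
  ultimately show ?thesis
    using subsetD[OF submodule_carrier[OF H(1)]] M.smult_assoc2
    by (simp add: algebra_def algebra_axioms_def)
qed

lemma subalg_image:
  assumes "algebra K M" "algebra K N" "h \<in> alg_hom K M N"
  shows "subalg K N (h ` carrier M)"
proof -
  interpret M: algebra K M by fact
  interpret N: algebra K N by fact
  interpret h: ring_hom_cring M N h
    using alg_hom_ring_hom_cring assms .
  have ring: "subring (h ` carrier M) N"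
    using h.ring.img_is_subring M.carrier_is_subring by blast
  have "submodule (h ` carrier M) K N"
  proof (rule N.submoduleI)
    fix c x assume "c \<in> carrier K" "x \<in> h ` carrier M"
    then show "c \<odot>\<^bsub>N\<^esub> x \<in> h ` carrier M"
      by (auto simp flip: alg_homD(2)[OF assms(3)])
  qed (use subringE[OF ring] in auto)
  with ring show ?thesis
    by (simp add: subalg_def)
qed

text \<open>First isomorphism theorem, with the map directed from the image to the quotient. The
  fibre of \<open>h\<close> over \<open>h x\<close> is the coset of \<open>x\<close>, so
  \<open>g\<close> needs no choice of representatives. Zero gets a clause of its own because
  \<open>alg_hom\<close> only speaks of one, sums, products and scalars.\<close>

lemma quotient_alg_iso:
  assumes "algebra K M" "algebra K N" "h \<in> alg_hom K M N"
  defines "g \<equiv> \<lambda>y. {x \<in> carrier M. h x = y}"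
  shows "g \<in> alg_hom K (N\<lparr>carrier := h ` carrier M\<rparr>) (quotient_alg M (a_kernel M N h))"
    and "bij_betw g (h ` carrier M) (carrier (quotient_alg M (a_kernel M N h)))"
    and "g \<zero>\<^bsub>N\<^esub> = \<zero>\<^bsub>quotient_alg M (a_kernel M N h)\<^esub>"
    and "\<And>x. x \<in> carrier M \<Longrightarrow> g (h x) = a_kernel M N h +>\<^bsub>M\<^esub> x"
proof -
  interpret M: algebra K M by fact
  interpret N: algebra K N by fact
  interpret h: ring_hom_cring M N h
    using alg_hom_ring_hom_cring assms(1-3) .
  let ?I = "a_kernel M N h"
  let ?Q = "quotient_alg M ?I"
  interpret I: ideal ?I M
    by (rule h.ring.kernel_is_ideal)
  show coset: "g (h x) = ?I +>\<^bsub>M\<^esub> x" if "x \<in> carrier M" for x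
    using h.ring.rcos_eq_homeq[OF that] by (simp add: g_def)
  show "g \<zero>\<^bsub>N\<^esub> = \<zero>\<^bsub>?Q\<^esub>"
    unfolding g_def quotient_alg_def FactRing_def a_kernel_def' by simp
  have smult: "c \<odot>\<^bsub>?Q\<^esub> g (h x) = g (h (c \<odot>\<^bsub>M\<^esub> x))"
    if c: "c \<in> carrier K" and x: "x \<in> carrier M" for c x
  proof -
    \<comment> \<open>Scalar multiplication of a coset is a union over all its representatives
      \<open>y\<close>. All sets in that union are one coset, since \<open>h y = h x\<close> forces
      equal values on the scaled elements; the member \<open>x\<close> then makes sure that the
      union is not over the empty set.\<close>
    have "?I +>\<^bsub>M\<^esub> (c \<odot>\<^bsub>M\<^esub> y) = g (h (c \<odot>\<^bsub>M\<^esub> x))" if "y \<in> g (h x)" for y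
    proof -
      have y: "y \<in> carrier M" "h y = h x"
        using that by (auto simp: g_def)
      then have "h (c \<odot>\<^bsub>M\<^esub> y) = h (c \<odot>\<^bsub>M\<^esub> x)"
        using alg_homD(2)[OF assms(3)] c x by simp
      then show ?thesis
        using coset[OF M.smult_closed[OF c y(1)]] by simp
    qed
    moreover have "x \<in> g (h x)"
      using x by (simp add: g_def)
    ultimately show ?thesis
      by (auto simp: quotient_alg_def)
  qed
  have "g \<in> ring_hom (N\<lparr>carrier := h ` carrier M\<rparr>) ?Q"
  proof (rule ring_hom_memI)
    fix u assume "u \<in> carrier (N\<lparr>carrier := h ` carrier M\<rparr>)"
    then obtain x where x: "x \<in> carrier M" "u = h x"
      by auto
    then show "g u \<in> carrier ?Q"
      by (auto simp: quotient_alg_def FactRing_def A_RCOSETS_def' coset)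
    fix v assume "v \<in> carrier (N\<lparr>carrier := h ` carrier M\<rparr>)"
    then obtain y where y: "y \<in> carrier M" "v = h y"
      by auto
    have "g (h (x \<otimes>\<^bsub>M\<^esub> y)) = g (h x) \<otimes>\<^bsub>?Q\<^esub> g (h y)"
      unfolding coset[OF x(1)] coset[OF y(1)] coset[OF M.m_closed[OF x(1) y(1)]]
      using I.rcoset_mult_add[OF x(1) y(1)] by (simp add: quotient_alg_def FactRing_def)
    then show "g (u \<otimes>\<^bsub>N\<lparr>carrier := h ` carrier M\<rparr>\<^esub> v) = g u \<otimes>\<^bsub>?Q\<^esub> g v"
      using x y by simp
    have "g (h (x \<oplus>\<^bsub>M\<^esub> y)) = g (h x) \<oplus>\<^bsub>?Q\<^esub> g (h y)"
      unfolding coset[OF x(1)] coset[OF y(1)] coset[OF M.add.m_closed[OF x(1) y(1)]]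
      using I.a_rcos_sum[OF x(1) y(1)] by (simp add: quotient_alg_def FactRing_def)
    then show "g (u \<oplus>\<^bsub>N\<lparr>carrier := h ` carrier M\<rparr>\<^esub> v) = g u \<oplus>\<^bsub>?Q\<^esub> g v"
      using x y by simp
  next
    show "g \<one>\<^bsub>N\<lparr>carrier := h ` carrier M\<rparr>\<^esub> = \<one>\<^bsub>?Q\<^esub>"
      using coset[OF M.one_closed] by (simp add: quotient_alg_def FactRing_def)
  qed
  moreover have "g (c \<odot>\<^bsub>N\<^esub> u) = c \<odot>\<^bsub>?Q\<^esub> g u" if "c \<in> carrier K" "u \<in> h ` carrier M" for c u
    using that alg_homD(2)[OF assms(3)] smult by auto
  ultimately show "g \<in> alg_hom K (N\<lparr>carrier := h ` carrier M\<rparr>) ?Q"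
    by (simp add: alg_hom_def)
  show "bij_betw g (h ` carrier M) (carrier ?Q)"
    unfolding bij_betw_def
  proof
    show "inj_on g (h ` carrier M)"
      by (auto simp: inj_on_def g_def)
    show "g ` h ` carrier M = carrier ?Q"
      by (auto simp: quotient_alg_def FactRing_def A_RCOSETS_def' image_image coset)
  qed
qed

text \<open>Each axiom for \<open>N\<close> is pulled back along the surjection \<open>h\<close> to
  the same axiom for \<open>M\<close>. Nothing is known of \<open>N\<close> beforehand, so
  preservation of zero has to be assumed separately.\<close>

lemma algebra_transport:
  assumes "algebra K M" "h \<in> alg_hom K M N" "bij_betw h (carrier M) (carrier N)" "h \<zero>\<^bsub>M\<^esub> = \<zero>\<^bsub>N\<^esub>"
  shows "algebra K N"
proof -
  interpret M: algebra K M by fact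
  note hom = alg_homD[OF assms(2)]
  have surj: "carrier N = h ` carrier M"
    using assms(3) by (simp add: bij_betw_def)
  have "h \<in> ring_iso M N"
    using hom assms(3) by (simp add: ring_iso_def)
  \<comment> \<open>The rule yields a ring whose zero is replaced by the image of the zero of
    \<open>M\<close>; \<open>assms(4)\<close> says that this is the zero \<open>N\<close> already
    has.\<close>
  from M.ring_iso_imp_img_cring[OF this] have "cring N"
    by (simp add: assms(4))
  note simps = ring_hom_add[OF hom(1), symmetric] ring_hom_mult[OF hom(1), symmetric]
    hom(2)[symmetric]
  show ?thesis
    by (rule algebraI[OF M.R_cring \<open>cring N\<close>])
       (auto simp: surj simps M.smult_l_distr M.smult_r_distr M.smult_assoc1 M.smult_assoc2)
qed

text \<open>Decompositions in \<open>N\<close> are exactly the images under \<open>h\<close> of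
  decompositions in \<open>M\<close>, so existence and uniqueness cross the bijection together. The
  coordinate ring will receive its grading from \<open>R(A)\<close> in this way, with no separate
  argument about cosets of forms.\<close>

lemma graded_algebra_transport:
  assumes "graded_algebra K M G" "h \<in> alg_hom K M N"
    and "bij_betw h (carrier M) (carrier N)" "h \<zero>\<^bsub>M\<^esub> = \<zero>\<^bsub>N\<^esub>"
  shows "graded_algebra K N (\<lambda>d. h ` G d)"
proof -
  have algM: "algebra K M" and sub: "\<And>d. submodule (G d) K M"
    and decomp: "\<forall>x\<in>carrier M. \<exists>!y. (\<forall>d. y d \<in> G d) \<and> finite {d. y d \<noteq> \<zero>\<^bsub>M\<^esub>} \<and>
                   x = (\<Oplus>\<^bsub>M\<^esub>d\<in>{d. y d \<noteq> \<zero>\<^bsub>M\<^esub>}. y d)"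
    using assms(1) by (simp_all add: graded_algebra_def)
  have algN: "algebra K N"
    using algebra_transport[OF algM assms(2-4)] .
  interpret M: algebra K M by fact
  interpret N: algebra K N by fact
  interpret h: ring_hom_cring M N h
    using alg_hom_ring_hom_cring[OF algM algN assms(2)] .
  note carr = subsetD[OF submodule_carrier[OF sub]]
  note subE = M.submoduleE[OF sub]
  note inj = inj_onD[OF bij_betw_imp_inj_on[OF assms(3)]]
  have "submodule (h ` G d) K N" for d
  proof (rule N.submoduleI)
    show "h ` G d \<subseteq> carrier N"
      using carr by auto
    show "\<zero>\<^bsub>N\<^esub> \<in> h ` G d"
      using subgroup.one_closed[OF submodule.axioms(1)[OF sub[of d]]]
      by (auto simp flip: assms(4))
  next
    fix x assume "x \<in> h ` G d"
    then show "\<ominus>\<^bsub>N\<^esub> x \<in> h ` G d"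
      using carr subE(3) by (auto simp flip: h.hom_a_inv)
  next
    fix x y assume "x \<in> h ` G d" "y \<in> h ` G d"
    then show "x \<oplus>\<^bsub>N\<^esub> y \<in> h ` G d"
      using carr subE(5) by (auto simp flip: h.hom_add)
  next
    fix c x assume "c \<in> carrier K" "x \<in> h ` G d"
    then show "c \<odot>\<^bsub>N\<^esub> x \<in> h ` G d"
      using carr subE(4) by (auto simp flip: alg_homD(2)[OF assms(2)])
  qed
  moreover have "x \<otimes>\<^bsub>N\<^esub> y \<in> h ` G (d + e)" if "x \<in> h ` G d" "y \<in> h ` G e" for d e x y
    using that assms(1) carr by (auto simp: graded_algebra_def simp flip: h.hom_mult)
  moreover have "\<exists>!y. (\<forall>d. y d \<in> h ` G d) \<and> finite {d. y d \<noteq> \<zero>\<^bsub>N\<^esub>} \<and>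
                      x = (\<Oplus>\<^bsub>N\<^esub>d\<in>{d. y d \<noteq> \<zero>\<^bsub>N\<^esub>}. y d)" (is "\<exists>!y. ?Q x y")
    if "x \<in> carrier N" for x
  proof -
    have "x \<in> h ` carrier M"
      using that by (simp only: bij_betw_imp_surj_on[OF assms(3)])
    then obtain x' where x': "x' \<in> carrier M" "x = h x'"
      by (elim imageE)
    let ?P = "\<lambda>y. (\<forall>d. y d \<in> G d) \<and> finite {d. y d \<noteq> \<zero>\<^bsub>M\<^esub>} \<and>
                    x' = (\<Oplus>\<^bsub>M\<^esub>d\<in>{d. y d \<noteq> \<zero>\<^bsub>M\<^esub>}. y d)"
    have P1: "\<exists>!y. ?P y"
      using x'(1) by (rule bspec[OF decomp])
    \<comment> \<open>The supports agree because \<open>h\<close> kills only zero, and the sums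
      correspond because \<open>h\<close> is additive; injectivity then reflects the equation from
      \<open>N\<close> back to \<open>M\<close>.\<close>
    have PQ: "?Q x (h \<circ> y) \<longleftrightarrow> ?P y" if y: "\<And>d. y d \<in> G d" for y
    proof -
      have "h z = \<zero>\<^bsub>N\<^esub> \<longleftrightarrow> z = \<zero>\<^bsub>M\<^esub>" if "z \<in> carrier M" for z
        using inj[of z "\<zero>\<^bsub>M\<^esub>"] that assms(4) by auto
      then have *: "{d. (h \<circ> y) d \<noteq> \<zero>\<^bsub>N\<^esub>} = {d. y d \<noteq> \<zero>\<^bsub>M\<^esub>}"
        using carr[OF y] by auto
      have yc: "y \<in> A \<rightarrow> carrier M" for A
        using carr[OF y] by auto
      have "(\<Oplus>\<^bsub>N\<^esub>d\<in>A. (h \<circ> y) d) = h (\<Oplus>\<^bsub>M\<^esub>d\<in>A. y d)" for A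
        using h.hom_finsum[OF yc, symmetric] .
      moreover have "h x' = h (\<Oplus>\<^bsub>M\<^esub>d\<in>A. y d) \<longleftrightarrow> x' = (\<Oplus>\<^bsub>M\<^esub>d\<in>A. y d)" for A
        using inj[of x'] x'(1) M.M.finsum_closed[OF yc] by blast
      ultimately show ?thesis
        unfolding * x'(2) using y by auto
    qed
    obtain y where y: "?P y"
      using P1 by blast
    show ?thesis
    proof (rule ex1I)
      show "?Q x (h \<circ> y)"
        using y PQ by blast
    next
      fix z assume z: "?Q x z"
      \<comment> \<open>A competing family lifts through \<open>h\<close> degree by degree, and
        uniqueness in \<open>M\<close> applies to the lift.\<close>
      then have "\<forall>d. \<exists>u. u \<in> G d \<and> z d = h u"
        by blast
      then obtain u where u: "\<And>d. u d \<in> G d" "\<And>d. z d = h (u d)"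
        by metis
      then have "z = h \<circ> u"
        by auto
      with z PQ[OF u(1)] have "?P u"
        by blast
      with y P1 have "u = y"
        by blast
      with \<open>z = h \<circ> u\<close> show "z = h \<circ> y"
        by simp
    qed
  qed
  ultimately show ?thesis
    using algN by (simp add: graded_algebra_def)
qed


section \<open>Polynomial algebras\<close>

lemma mvar_power: "mvar v ^ k = Poly_Mapping.single (Poly_Mapping.single v k) 1"
  by (induction k) (simp_all add: mvar_def mult_single flip: single_add)

text \<open>A polynomial is a finite sum of constants times products of powers of variables. The
  steps for sums and products supply carrier membership because the laws of a morphism hold on the
  carrier only; \<open>Q\<close> carries that membership along.\<close>

lemma mpoly_alg_induct [consumes 1, case_names const var add mult]:
  assumes "p \<in> carrier (mpoly_alg Vs)"
    and "\<And>c. P (mconst c)"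
    and "\<And>v. v \<in> Vs \<Longrightarrow> P (mvar v)"
    and "\<And>p q. p \<in> carrier (mpoly_alg Vs) \<Longrightarrow> q \<in> carrier (mpoly_alg Vs) \<Longrightarrow> P p \<Longrightarrow> P q \<Longrightarrow> P (p + q)"
    and "\<And>p q. p \<in> carrier (mpoly_alg Vs) \<Longrightarrow> q \<in> carrier (mpoly_alg Vs) \<Longrightarrow> P p \<Longrightarrow> P q \<Longrightarrow> P (p * q)"
  shows "P (p :: ('v, 'k::field) mpoly)"
proof -
  interpret algebra base_field "mpoly_alg Vs :: ('k, ('v, 'k) mpoly) module"
    by (rule mpoly_alg_algebra)
  define Q where "Q = (\<lambda>x :: ('v, 'k) mpoly. x \<in> carrier (mpoly_alg Vs) \<and> P x)"
  have add: "Q (x + y)" and mult: "Q (x * y)" if "Q x" "Q y" for x y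
    using that assms(4,5)[of x y] M.add.m_closed[of x y] m_closed[of x y]
    by (auto simp: Q_def mpoly_alg_def)
  have const: "Q (mconst c)" for c
    using assms(2) by (auto simp: Q_def mpoly_alg_def mconst_def)
  have var: "Q (mvar v)" if "v \<in> Vs" for v
    using assms(3) that by (auto simp: Q_def mpoly_alg_def mvar_def)
  have power: "Q (x ^ k)" if "Q x" for x k
    using that const[of 1] by (induction k) (auto simp: mult mconst_one)
  have monomial: "Q (\<Prod>v\<in>S. mvar v ^ k v)" if "finite S" "S \<subseteq> Vs" for S and k :: "'v \<Rightarrow> nat"
    using that const[of 1] by induction (auto simp: mult power var mconst_one)
  have eq: "Poly_Mapping.single m 1 =
      (\<Prod>v\<in>Poly_Mapping.keys m. mvar v ^ Poly_Mapping.lookup m v :: ('v, 'k) mpoly)" for m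
  proof -
    \<comment> \<open>Multiplying monomials adds exponent vectors. The rule
      \<open>mpoly_sum_monomials\<close>, applied to the finitely supported function
      \<open>m\<close> itself, then rebuilds \<open>m\<close> from its one-variable parts.\<close>
    have "(\<Prod>v\<in>S. Poly_Mapping.single (f v) 1) = (Poly_Mapping.single (sum f S) 1 :: ('v, 'k) mpoly)"
      for f and S :: "'v set"
      by (induction S rule: infinite_finite_induct) (simp_all add: mult_single)
    then show ?thesis
      by (simp add: mvar_power mpoly_sum_monomials)
  qed
  have single: "Q (Poly_Mapping.single m c)" if "Poly_Mapping.keys m \<subseteq> Vs" for m c
  proof -
    have "Q (mconst c * Poly_Mapping.single m 1)"
      unfolding eq using that by (intro mult const monomial) auto
    then show ?thesis
      by (simp add: mconst_def mult_single)
  qed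
  have "Q (\<Sum>m\<in>S. Poly_Mapping.single m (Poly_Mapping.lookup p m))"
    if "finite S" "S \<subseteq> Poly_Mapping.keys p" for S
    using that
  proof induction
    case empty
    then show ?case
      using const[of 0] by (simp add: mconst_zero)
  next
    case (insert m S)
    then show ?case
      using assms(1) by (auto simp: mpoly_alg_def intro!: add single)
  qed
  from this[of "Poly_Mapping.keys p"] show ?thesis
    by (simp add: mpoly_sum_monomials Q_def)
qed

text \<open>Two morphisms that agree on the variables agree everywhere; constants are scalar
  multiples of one. This makes the abstract \<open>\<phi>\<close> and \<open>\<psi>\<close>
  computable.\<close>

lemma alg_hom_eq_substitute:
  assumes "h \<in> alg_hom base_field (mpoly_alg Vs) (mpoly_alg UNIV)"
    and "\<And>v. v \<in> Vs \<Longrightarrow> h (mvar v) = b v" and "p \<in> carrier (mpoly_alg Vs)"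
  shows "h p = substitute b p"
  using assms(3)
proof (induction rule: mpoly_alg_induct)
  case (const c)
  have "h (mconst c) = mconst c * h 1"
    using alg_homD(2)[OF assms(1), of c 1] by (simp add: mpoly_alg_def base_field_def)
  moreover have "h 1 = 1"
    using ring_hom_one[OF alg_homD(1)[OF assms(1)]] by (simp add: mpoly_alg_def)
  ultimately show ?case
    using substitute_single[of b 0 c] by (simp add: mconst_def monomial_value_def)
next
  case (var v)
  then show ?case
    by (simp add: assms(2) substitute_mvar)
next
  case (add p q)
  then show ?case
    using ring_hom_add[OF alg_homD(1)[OF assms(1)], of p q]
    by (simp add: mpoly_alg_def substitute_add)
next
  case (mult p q)
  then show ?case
    using ring_hom_mult[OF alg_homD(1)[OF assms(1)], of p q]
    by (simp add: mpoly_alg_def substitute_mult)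
qed

text \<open>The image of \<open>h\<close> is one of the subalgebras being intersected. Conversely, a
  subalgebra containing all \<open>b v\<close> contains every \<open>h p\<close>, by induction on
  \<open>p\<close>. Thus \<open>R(A)\<close> becomes the image of \<open>\<phi>\<close>.\<close>

lemma carrier_generated_mpoly_alg:
  assumes "h \<in> alg_hom base_field (mpoly_alg Vs) (mpoly_alg UNIV)"
    and "\<And>v. v \<in> Vs \<Longrightarrow> h (mvar v) = b v"
  shows "carrier (generated_alg base_field (mpoly_alg UNIV) (b ` Vs)) = h ` carrier (mpoly_alg Vs)"
    (is "carrier (generated_alg ?K ?N ?S) = h ` carrier ?M")
proof -
  have "mvar v \<in> carrier ?M" if "v \<in> Vs" for v
    using that by (simp add: mpoly_alg_def mvar_def)
  then have "?S \<subseteq> h ` carrier ?M"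
    using assms(2) by (auto simp: image_iff) metis
  then have "carrier (generated_alg ?K ?N ?S) \<subseteq> h ` carrier ?M"
    using subalg_image[OF mpoly_alg_algebra mpoly_alg_algebra assms(1)]
    by (auto simp: generated_alg_def)
  moreover have "h p \<in> H" if H: "subalg ?K ?N H" "?S \<subseteq> H" and ring: "subring H ?N"
    and "p \<in> carrier ?M" for H p
    using that(4)
  proof (induction rule: mpoly_alg_induct)
    case (const c)
    have "c \<odot>\<^bsub>?N\<^esub> 1 \<in> H"
      using H(1) subringE(3)[OF ring] by (intro submodule.smult_closed[of H ?K ?N])
        (auto simp: subalg_def base_field_def mpoly_alg_def)
    moreover have "h (mconst c) = mconst c"
      using alg_hom_eq_substitute[OF assms, of "mconst c"] substitute_single[of b 0 c]
      by (simp add: mpoly_alg_def mconst_def monomial_value_def)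
    ultimately show ?case
      by (simp add: mpoly_alg_def)
  next
    case (var v)
    then show ?case
      using H(2) assms(2) by auto
  next
    case (add p q)
    then show ?case
      using ring_hom_add[OF alg_homD(1)[OF assms(1)], of p q] subringE(7)[OF ring, of "h p" "h q"]
      by (simp add: mpoly_alg_def)
  next
    case (mult p q)
    then show ?case
      using ring_hom_mult[OF alg_homD(1)[OF assms(1)], of p q] subringE(6)[OF ring, of "h p" "h q"]
      by (simp add: mpoly_alg_def)
  qed
  then have "h ` carrier ?M \<subseteq> carrier (generated_alg ?K ?N ?S)"
    by (auto simp: generated_alg_def subalg_def)
  ultimately show ?thesis
    by blast
qed


section \<open>Homogeneous components\<close>

text \<open>The degree occurring in \<open>homogeneous\<close>. With the weights \<open>a i\<close>,
  \<open>a n - a i\<close> and \<open>1\<close>, the same function also gives the exponents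
  \<open>s\<close>, \<open>r\<close> and \<open>d\<close> of the images of monomials.\<close>

definition weight :: "('v \<Rightarrow> nat) \<Rightarrow> ('v \<Rightarrow>\<^sub>0 nat) \<Rightarrow> nat" where
  "weight \<omega> m = (\<Sum>v\<in>Poly_Mapping.keys m. Poly_Mapping.lookup m v * \<omega> v)"

lemma homogeneous_iff: "p \<in> homogeneous \<omega> d \<longleftrightarrow> (\<forall>m\<in>Poly_Mapping.keys p. weight \<omega> m = d)"
  by (simp add: homogeneous_def weight_def)

lemma weight_add: "weight \<omega> (m + m') = weight \<omega> m + weight \<omega> m'"
proof -
  let ?S = "Poly_Mapping.keys m \<union> Poly_Mapping.keys m'"
  have *: "weight \<omega> k = (\<Sum>v\<in>?S. Poly_Mapping.lookup k v * \<omega> v)" if "Poly_Mapping.keys k \<subseteq> ?S" for k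
    unfolding weight_def using that by (intro sum.mono_neutral_left) (auto simp: in_keys_iff)
  show ?thesis
    using Poly_Mapping.keys_add[of m m']
    by (simp add: * lookup_add sum.distrib distrib_right)
qed

lemma weight_single: "weight \<omega> (Poly_Mapping.single v k) = k * \<omega> v"
  by (simp add: weight_def)

definition hcomp :: "('v \<Rightarrow> nat) \<Rightarrow> nat \<Rightarrow> ('v, 'k::comm_monoid_add) mpoly \<Rightarrow> ('v, 'k) mpoly" where
  "hcomp \<omega> d p = (\<Sum>m\<in>{m \<in> Poly_Mapping.keys p. weight \<omega> m = d}.
                    Poly_Mapping.single m (Poly_Mapping.lookup p m))"

lemma lookup_hcomp:
  "Poly_Mapping.lookup (hcomp \<omega> d p) m = (if weight \<omega> m = d then Poly_Mapping.lookup p m else 0)"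
  by (auto simp: hcomp_def lookup_sum lookup_single when_def in_keys_iff)

lemma keys_hcomp: "Poly_Mapping.keys (hcomp \<omega> d p) = {m \<in> Poly_Mapping.keys p. weight \<omega> m = d}"
  by (auto simp: in_keys_iff lookup_hcomp split: if_splits)

lemma hcomp_homogeneous: "hcomp \<omega> d p \<in> homogeneous \<omega> d"
  by (simp add: homogeneous_iff keys_hcomp)

lemma hcomp_of_homogeneous:
  assumes "p \<in> homogeneous \<omega> e"
  shows "hcomp \<omega> d p = (if d = e then p else 0)"
  using assms
  by (intro poly_mapping_eqI) (auto simp: lookup_hcomp homogeneous_iff in_keys_iff)

lemma hcomp_sum: "hcomp \<omega> d (sum f S) = (\<Sum>x\<in>S. hcomp \<omega> d (f x))"
  by (intro poly_mapping_eqI) (simp add: lookup_hcomp lookup_sum)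

lemma hcomp_nonzero_finite: "finite {d. hcomp \<omega> d p \<noteq> 0}"
proof (rule finite_subset)
  show "{d. hcomp \<omega> d p \<noteq> 0} \<subseteq> weight \<omega> ` Poly_Mapping.keys p"
    by (auto simp flip: keys_eq_empty simp: keys_hcomp)
qed simp

lemma sum_hcomp: "(\<Sum>d\<in>{d. hcomp \<omega> d p \<noteq> 0}. hcomp \<omega> d p) = p"
proof (intro poly_mapping_eqI)
  fix m
  \<comment> \<open>The sum skips degrees whose component vanishes; a monomial of such a degree has
    coefficient zero in \<open>p\<close>, so nothing is lost.\<close>
  have "Poly_Mapping.lookup p m = 0" if "hcomp \<omega> (weight \<omega> m) p = 0"
    using arg_cong[OF that, of "\<lambda>q. Poly_Mapping.lookup q m"] by (simp add: lookup_hcomp)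
  then show "Poly_Mapping.lookup (\<Sum>d\<in>{d. hcomp \<omega> d p \<noteq> 0}. hcomp \<omega> d p) m = Poly_Mapping.lookup p m"
    by (auto simp: lookup_sum lookup_hcomp hcomp_nonzero_finite)
qed

lemma homogeneous_mult:
  assumes "p \<in> homogeneous \<omega> d" "q \<in> homogeneous \<omega> e"
  shows "p * q \<in> homogeneous \<omega> (d + e)"
  using assms Poly_Mapping.keys_mult[of p q] by (fastforce simp: homogeneous_iff weight_add)

text \<open>Closure under taking components is what makes a subalgebra graded: the components of an
  element lie in \<open>H\<close> and add up to it.\<close>

lemma graded_algebra_mpoly_subalg:
  fixes H :: "('v, 'k::field) mpoly set"
  assumes "subalg base_field (mpoly_alg Vs) H" and "\<And>p d. p \<in> H \<Longrightarrow> hcomp \<omega> d p \<in> H"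
  shows "graded_algebra base_field ((mpoly_alg Vs)\<lparr>carrier := H\<rparr>) (\<lambda>d. H \<inter> homogeneous \<omega> d)"
proof -
  let ?M = "(mpoly_alg Vs :: ('k, ('v, 'k) mpoly) module)\<lparr>carrier := H\<rparr>"
  have alg: "algebra base_field ?M"
    using subalg_algebra[OF mpoly_alg_algebra assms(1)] .
  interpret algebra base_field ?M by fact
  note simps = mpoly_alg_def base_field_def
  have closed: "x + y \<in> H" "x * y \<in> H" if "x \<in> H" "y \<in> H" for x y
    using M.add.m_closed[of x y] m_closed[of x y] that by (auto simp: simps)
  have zero: "0 \<in> H"
    using M.zero_closed by (simp add: simps)
  have scalar: "mconst c * x \<in> H" if "x \<in> H" for c x
    using smult_closed[of c x] that by (simp add: simps)
  have minus: "\<ominus>\<^bsub>?M\<^esub> x = - x" if "x \<in> H" for x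
    using M.l_neg[of x] that by (simp add: simps eq_neg_iff_add_eq_0)
  have finsum: "(\<Oplus>\<^bsub>?M\<^esub>d\<in>D. y d) = sum y D" if "finite D" "\<And>d. d \<in> D \<Longrightarrow> y d \<in> H"
    for y and D :: "nat set"
    using that
  proof induction
    case empty
    then show ?case
      by (subst M.finsum_empty) (simp add: mpoly_alg_def)
  next
    case (insert d D)
    then show ?case
      by (subst M.finsum_insert) (auto simp: mpoly_alg_def)
  qed
  have sub: "submodule (H \<inter> homogeneous \<omega> d) base_field ?M" for d
  proof (rule submoduleI)
    fix x assume "x \<in> H \<inter> homogeneous \<omega> d"
    then show "\<ominus>\<^bsub>?M\<^esub> x \<in> H \<inter> homogeneous \<omega> d"
      using M.add.inv_closed[of x] minus[of x] by (auto simp: homogeneous_iff a_inv_def)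
  next
    fix x y assume "x \<in> H \<inter> homogeneous \<omega> d" "y \<in> H \<inter> homogeneous \<omega> d"
    then show "x \<oplus>\<^bsub>?M\<^esub> y \<in> H \<inter> homogeneous \<omega> d"
      using closed(1) Poly_Mapping.keys_add[of x y]
      by (fastforce simp: homogeneous_iff mpoly_alg_def)
  next
    fix c :: 'k and x assume "x \<in> H \<inter> homogeneous \<omega> d"
    moreover have "mconst c \<in> homogeneous \<omega> 0"
      by (simp add: homogeneous_iff mconst_def weight_def)
    ultimately show "c \<odot>\<^bsub>?M\<^esub> x \<in> H \<inter> homogeneous \<omega> d"
      using scalar homogeneous_mult[of "mconst c" \<omega> 0 x d] by (simp add: mpoly_alg_def)
  qed (auto simp: mpoly_alg_def zero homogeneous_iff)
  have decomp: "\<exists>!y. (\<forall>d. y d \<in> H \<inter> homogeneous \<omega> d) \<and> finite {d. y d \<noteq> 0} \<and>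
                  x = (\<Oplus>\<^bsub>?M\<^esub>d\<in>{d. y d \<noteq> 0}. y d)" if "x \<in> H" for x
  proof (rule ex1I[of _ "\<lambda>d. hcomp \<omega> d x"])
    show "(\<forall>d. hcomp \<omega> d x \<in> H \<inter> homogeneous \<omega> d) \<and> finite {d. hcomp \<omega> d x \<noteq> 0} \<and>
          x = (\<Oplus>\<^bsub>?M\<^esub>d\<in>{d. hcomp \<omega> d x \<noteq> 0}. hcomp \<omega> d x)"
      using assms(2) that
      by (simp add: hcomp_homogeneous hcomp_nonzero_finite finsum sum_hcomp)
  next
    fix y
    assume y: "(\<forall>d. y d \<in> H \<inter> homogeneous \<omega> d) \<and> finite {d. y d \<noteq> 0} \<and>
               x = (\<Oplus>\<^bsub>?M\<^esub>d\<in>{d. y d \<noteq> 0}. y d)"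
    then have fin: "finite {d. y d \<noteq> 0}" and x: "x = (\<Sum>d\<in>{d. y d \<noteq> 0}. y d)"
      by (simp_all add: finsum)
    show "y = (\<lambda>d. hcomp \<omega> d x)"
    proof
      fix e
      \<comment> \<open>Uniqueness: projecting the given decomposition to degree \<open>e\<close>
        leaves only \<open>y e\<close>, and gives zero if \<open>e\<close> is outside the
        support.\<close>
      have "hcomp \<omega> e (y d) = (if e = d then y d else 0)" for d
        using y by (intro hcomp_of_homogeneous) blast
      then show "y e = hcomp \<omega> e x"
        using fin by (simp add: x hcomp_sum)
    qed
  qed
  show ?thesis
    unfolding graded_algebra_def
    using alg sub decomp closed(2) by (auto simp: mpoly_alg_def homogeneous_mult)
qed


section \<open>Morphisms with monomial values\<close>

text \<open>One formula serves both morphisms: the weights are \<open>a i\<close> and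
  \<open>1\<close> for \<open>\<phi>\<close>, and \<open>a n - a i\<close> and \<open>a i\<close>
  for \<open>\<psi>\<close>.\<close>

lemma monomial_value_two_variables:
  "monomial_value (\<lambda>v. mvar x ^ f v * mvar y ^ g v) m =
     Poly_Mapping.single (Poly_Mapping.single x (weight f m) + Poly_Mapping.single y (weight g m)) 1"
proof -
  have "monomial_value (\<lambda>v. mvar x ^ f v * mvar y ^ g v) m = mvar x ^ weight f m * mvar y ^ weight g m"
    by (simp add: monomial_value_def weight_def power_mult_distrib prod.distrib power_sum
             flip: power_mult) (simp add: mult.commute)
  then show ?thesis
    by (simp add: mvar_power mult_single)
qed

lemma single_add_single_eq_iff:
  assumes "x \<noteq> y"
  shows "Poly_Mapping.single x s + Poly_Mapping.single y d =
           Poly_Mapping.single x s' + Poly_Mapping.single y d' \<longleftrightarrow> s = s' \<and> d = (d' :: nat)"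
proof
  assume eq: "Poly_Mapping.single x s + Poly_Mapping.single y d =
              Poly_Mapping.single x s' + Poly_Mapping.single y d'"
  show "s = s' \<and> d = d'"
    using arg_cong[OF eq, of "\<lambda>q. Poly_Mapping.lookup q x"]
      arg_cong[OF eq, of "\<lambda>q. Poly_Mapping.lookup q y"] assms
    by (simp add: lookup_add lookup_single)
qed simp

text \<open>Each term moves to the exponent \<open>e m\<close> with its coefficient, so coefficients
  accumulate along the fibres of \<open>e\<close>.\<close>

lemma lookup_substitute_monomials:
  assumes "\<And>m. m \<in> Poly_Mapping.keys p \<Longrightarrow> monomial_value b m = Poly_Mapping.single (e m) 1"
  shows "Poly_Mapping.lookup (substitute b p) k =
           (\<Sum>m\<in>{m \<in> Poly_Mapping.keys p. e m = k}. Poly_Mapping.lookup p m)"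
proof -
  have "substitute b p = (\<Sum>m\<in>Poly_Mapping.keys p. Poly_Mapping.single (e m) (Poly_Mapping.lookup p m))"
    unfolding substitute_def by (intro sum.cong refl) (simp add: assms mconst_def mult_single)
  then show ?thesis
    by (simp add: lookup_sum lookup_single when_def sum.inter_filter)
qed

text \<open>The kernel consists of the polynomials whose coefficients sum to zero over every fibre of the
  exponent map.\<close>

lemma substitute_monomials_zero_imp:
  assumes "\<And>m. m \<in> Poly_Mapping.keys p \<Longrightarrow> monomial_value b m = Poly_Mapping.single (e m) 1"
    and "\<And>m. m \<in> Poly_Mapping.keys p \<Longrightarrow> monomial_value b' m = Poly_Mapping.single (e' m) 1"
    and "\<And>m m'. m \<in> Poly_Mapping.keys p \<Longrightarrow> m' \<in> Poly_Mapping.keys p \<Longrightarrow> e m = e m' \<longleftrightarrow> e' m = e' m'"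
    and "substitute b p = 0"
  shows "substitute b' p = 0"
proof (rule poly_mapping_eqI)
  fix k
  have zero: "(\<Sum>m\<in>{m \<in> Poly_Mapping.keys p. e m = j}. Poly_Mapping.lookup p m) = 0" for j
    using lookup_substitute_monomials[of p b e j, OF assms(1)] assms(4) by simp
  have "(\<Sum>m\<in>{m \<in> Poly_Mapping.keys p. e' m = k}. Poly_Mapping.lookup p m) = 0"
  \<comment> \<open>A nonempty fibre of \<open>e'\<close> is also a fibre of \<open>e\<close>; over
    an empty one the sum has no terms.\<close>
  proof (cases "\<exists>m\<in>Poly_Mapping.keys p. e' m = k")
    case True
    then obtain m0 where m0: "m0 \<in> Poly_Mapping.keys p" "k = e' m0"
      by blast
    then have "{m \<in> Poly_Mapping.keys p. e' m = k} = {m \<in> Poly_Mapping.keys p. e m = e m0}"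
      using assms(3) by auto
    then show ?thesis
      using zero by simp
  next
    case False
    then show ?thesis
      by (intro sum.neutral) auto
  qed
  then show "Poly_Mapping.lookup (substitute b' p) k = Poly_Mapping.lookup 0 k"
    using lookup_substitute_monomials[of p b' e' k, OF assms(2)] by simp
qed

text \<open>If monomials keep their degree under substitution, constants being of degree 0, then
  projecting to degree \<open>d\<close> selects the same terms before and after.\<close>

lemma hcomp_substitute:
  assumes "\<And>m. m \<in> Poly_Mapping.keys p \<Longrightarrow> monomial_value b m \<in> homogeneous \<omega>' (weight \<omega> m)"
  shows "hcomp \<omega>' d (substitute b p) = substitute b (hcomp \<omega> d p)"
proof -
  let ?t = "\<lambda>m. mconst (Poly_Mapping.lookup p m) * monomial_value b m"
  have "hcomp \<omega>' d (?t m) = (if weight \<omega> m = d then ?t m else 0)"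
    if "m \<in> Poly_Mapping.keys p" for m
  proof -
    have "mconst (Poly_Mapping.lookup p m) \<in> homogeneous \<omega>' 0"
      by (simp add: homogeneous_iff mconst_def weight_def)
    then have "?t m \<in> homogeneous \<omega>' (weight \<omega> m)"
      using homogeneous_mult[OF _ assms[OF that]] by fastforce
    from hcomp_of_homogeneous[OF this] show ?thesis
      by auto
  qed
  then have "hcomp \<omega>' d (substitute b p) =
      (\<Sum>m\<in>Poly_Mapping.keys p. if weight \<omega> m = d then ?t m else 0)"
    by (simp add: substitute_def hcomp_sum)
  also have "\<dots> = (\<Sum>m\<in>Poly_Mapping.keys (hcomp \<omega> d p). ?t m)"
    by (simp add: keys_hcomp sum.inter_filter)
  also have "\<dots> = substitute b (hcomp \<omega> d p)"
    unfolding substitute_def by (intro sum.cong refl) (simp add: keys_hcomp lookup_hcomp)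
  finally show ?thesis .
qed


section \<open>The two toric presentations\<close>

theorem proposition2p6:
  fixes n :: nat and a :: "nat \<Rightarrow> int"
    and \<phi> :: "(nat, 'k::field) mpoly \<Rightarrow> (tw_var, 'k) mpoly"
    and \<psi> :: "(nat, 'k) mpoly \<Rightarrow> (uv_var, 'k) mpoly"
    and I_A :: "(nat, 'k) mpoly set"
  assumes "infinite (UNIV :: 'k set)"
    and "n \<ge> 2"
    and "a 1 = 0"
    and "strict_mono_on {1..n} a"
    and "Gcd (a ` {2..n}) = 1"
    and "\<phi> \<in> alg_hom base_field (mpoly_alg {1..n}) (mpoly_alg UNIV)"
    and "\<forall>i\<in>{1..n}. \<phi> (mvar i) = mvar T ^ nat (a i) * mvar W"
    and "\<psi> \<in> alg_hom base_field (mpoly_alg {1..n}) (mpoly_alg UNIV)"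
    and "\<forall>i\<in>{1..n}. \<psi> (mvar i) = mvar U ^ nat (a n - a i) * mvar V ^ nat (a i)"
    and "I_A = a_kernel (mpoly_alg {1..n}) (mpoly_alg UNIV) \<psi>"
  shows "a_kernel (mpoly_alg {1..n}) (mpoly_alg UNIV) \<phi> = I_A \<and>
         graded_alg_isomorphic base_field
           (R_A n a) (R_A_component n a)
           (coord_ring n I_A) (coord_ring_component n I_A)"
proof -
  let ?P = "mpoly_alg {1..n} :: ('k, (nat, 'k) mpoly) module"
  let ?R = "mpoly_alg UNIV :: ('k, (tw_var, 'k) mpoly) module"

  \<comment> \<open>Exponents of the images of monomials\<close>
  define b where "b i = (mvar T ^ nat (a i) * mvar W ^ 1 :: (tw_var, 'k) mpoly)" for i
  define b' where "b' i = (mvar U ^ nat (a n - a i) * mvar V ^ nat (a i) :: (uv_var, 'k) mpoly)" for i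
  let ?s = "weight (\<lambda>i. nat (a i))" and ?d = "weight (\<lambda>_ :: nat. 1)"
    and ?r = "weight (\<lambda>i. nat (a n - a i))"
  \<comment> \<open>The exponent vectors \<open>(s, d)\<close> and \<open>(r, s)\<close> of the
    images of a monomial. The trivial power of \<open>W\<close> in \<open>b\<close> provides the
    constant weight 1 behind \<open>d\<close>.\<close>
  define e where "e m = Poly_Mapping.single T (?s m) + Poly_Mapping.single W (?d m)" for m
  define e' where "e' m = Poly_Mapping.single U (?r m) + Poly_Mapping.single V (?s m)" for m
  have mv: "monomial_value b m = Poly_Mapping.single (e m) 1" for m
    unfolding b_def e_def by (rule monomial_value_two_variables)
  have mv': "monomial_value b' m = Poly_Mapping.single (e' m) 1" for m
    unfolding b'_def e'_def by (rule monomial_value_two_variables)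
  have phi: "\<phi> p = substitute b p" if "p \<in> carrier ?P" for p
    using assms(7) by (intro alg_hom_eq_substitute[OF assms(6) _ that]) (simp add: b_def)
  have psi: "\<psi> p = substitute b' p" if "p \<in> carrier ?P" for p
    using assms(9) by (intro alg_hom_eq_substitute[OF assms(8) _ that]) (simp add: b'_def)

  \<comment> \<open>Equality of the kernels\<close>
  have range: "0 \<le> a i" "a i \<le> a n" if "i \<in> {1..n}" for i
  proof -
    have "mono_on {1..n} a"
      using assms(4) by (rule strict_mono_on_imp_mono_on)
    then show "0 \<le> a i" "a i \<le> a n"
      using that assms(2) mono_onD[of "{1..n}" a 1 i] mono_onD[of "{1..n}" a i n]
      assms(3) by auto
  qed
  have pos: "a n > 0"
    using strict_mono_onD[OF assms(4), of 1 n] assms(2,3) by simp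
  \<comment> \<open>The bounds in \<open>range\<close> make \<open>nat\<close> exact on both
    \<open>a i\<close> and \<open>a n - a i\<close>. The relation is kept additive, free of
    truncated subtraction of the weights.\<close>
  have total: "?r m + ?s m = nat (a n) * ?d m" if "Poly_Mapping.keys m \<subseteq> {1..n}" for m
  proof -
    have "nat (a n - a i) + nat (a i) = nat (a n)" if "i \<in> Poly_Mapping.keys m" for i
      using range[of i] that \<open>Poly_Mapping.keys m \<subseteq> {1..n}\<close> by (auto simp flip: nat_add_distrib)
    then have "?r m + ?s m = (\<Sum>i\<in>Poly_Mapping.keys m. Poly_Mapping.lookup m i * nat (a n))"
      by (simp add: weight_def flip: sum.distrib distrib_left)
    then show ?thesis
      by (simp add: weight_def sum_distrib_left mult.commute)
  qed
  have fibres: "e m = e m' \<longleftrightarrow> e' m = e' m'"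
    if "Poly_Mapping.keys m \<subseteq> {1..n}" "Poly_Mapping.keys m' \<subseteq> {1..n}" for m m'
  proof -
    \<comment> \<open>For equal \<open>s\<close>, \<open>total\<close> reduces equality of
      \<open>r\<close> to that of \<open>nat (a n) * d\<close>, and \<open>pos\<close> allows the
      factor to be cancelled.\<close>
    have "?s m = ?s m' \<and> ?d m = ?d m' \<longleftrightarrow> ?r m = ?r m' \<and> ?s m = ?s m'"
      using total[OF that(1)] total[OF that(2)] pos
      by (metis add_right_cancel mult_cancel1 zero_less_nat_eq less_irrefl)
    then show ?thesis
      by (simp add: e_def e'_def single_add_single_eq_iff)
  qed
  have "\<phi> p = 0 \<longleftrightarrow> \<psi> p = 0" if "p \<in> carrier ?P" for p
  proof -
    have keys: "Poly_Mapping.keys m \<subseteq> {1..n}" if "m \<in> Poly_Mapping.keys p" for m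
      using that \<open>p \<in> carrier ?P\<close> by (simp add: mpoly_alg_def)
    show ?thesis
      using substitute_monomials_zero_imp[of p b e b' e', OF mv mv' fibres[OF keys keys]]
        substitute_monomials_zero_imp[of p b' e' b e, OF mv' mv fibres[OF keys keys, symmetric]]
      by (auto simp: phi[OF that] psi[OF that])
  qed
  then have ker: "a_kernel ?P ?R \<phi> = I_A"
    by (auto simp: assms(10) a_kernel_def' mpoly_alg_def)

  \<comment> \<open>\<open>R(A)\<close> as a graded subalgebra\<close>
  have hcomp_carrier: "hcomp \<omega> d p \<in> carrier ?P" if "p \<in> carrier ?P" for \<omega> d p
    using that by (auto simp: mpoly_alg_def keys_hcomp)
  have hcomp_phi: "hcomp deg_tw d (\<phi> p) = \<phi> (hcomp (\<lambda>_. 1) d p)" if "p \<in> carrier ?P" for d p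
  proof -
    \<comment> \<open>As \<open>T\<close> has degree 0 and \<open>W\<close> degree 1, the image of a
      monomial has degree equal to the exponent of \<open>W\<close>, which is the total
      degree.\<close>
    have "monomial_value b m \<in> homogeneous deg_tw (?d m)" for m
      by (simp add: mv homogeneous_iff e_def weight_add weight_single deg_tw_def)
    then show ?thesis
      using hcomp_substitute[of p b deg_tw "\<lambda>_. 1" d]
      by (simp only: phi[OF that] phi[OF hcomp_carrier[OF that]])
  qed

  have gens: "(\<lambda>i. mvar T ^ nat (a i) * mvar W) ` {1..n} = b ` {1..n}"
    by (simp add: b_def)
  have "carrier (R_A n a) = \<phi> ` carrier ?P"
    unfolding R_A_def gens
    using assms(7) by (intro carrier_generated_mpoly_alg[OF assms(6)]) (simp add: b_def)
  \<comment> \<open>\<open>generated_alg\<close> changes only the carrier, so knowing the carrier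
    determines the whole record.\<close>
  then have R_A: "R_A n a = ?R\<lparr>carrier := \<phi> ` carrier ?P\<rparr>"
    by (simp add: R_A_def generated_alg_def)
  have comp: "R_A_component n a = (\<lambda>d. \<phi> ` carrier ?P \<inter> homogeneous deg_tw d)"
    by (simp add: R_A_component_def R_A fun_eq_iff)
  have graded: "graded_algebra (base_field :: 'k ring) (R_A n a) (R_A_component n a)"
    unfolding R_A comp
  proof (rule graded_algebra_mpoly_subalg)
    show "subalg base_field ?R (\<phi> ` carrier ?P)"
      using subalg_image[OF mpoly_alg_algebra mpoly_alg_algebra assms(6)] .
    fix q d assume "q \<in> \<phi> ` carrier ?P"
    then obtain p where p: "p \<in> carrier ?P" "q = \<phi> p"
      by blast
    show "hcomp deg_tw d q \<in> \<phi> ` carrier ?P"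
      unfolding p(2) hcomp_phi[OF p(1)] by (intro imageI hcomp_carrier p(1))
  qed

  \<comment> \<open>The graded isomorphism\<close>
  define g where "g y = {p \<in> carrier ?P. \<phi> p = y}" for y
  \<comment> \<open>Rewriting with \<open>ker\<close> turns the quotient by the kernel of
    \<open>\<phi>\<close> into the quotient by \<open>I_A\<close>; here the equality of kernels
    enters.\<close>
  note iso = quotient_alg_iso[OF mpoly_alg_algebra mpoly_alg_algebra assms(6),
      folded g_def, unfolded ker]
  have coord: "coord_ring n I_A = quotient_alg ?P I_A"
    by (simp add: coord_ring_def)
  have g_hom: "g \<in> alg_hom base_field (R_A n a) (coord_ring n I_A)"
    and g_bij: "bij_betw g (carrier (R_A n a)) (carrier (coord_ring n I_A))"
    and g_zero: "g \<zero>\<^bsub>R_A n a\<^esub> = \<zero>\<^bsub>coord_ring n I_A\<^esub>"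
    using iso(1-3) by (simp_all add: R_A coord)
  have component: "R_A_component n a d = \<phi> ` (carrier ?P \<inter> homogeneous (\<lambda>_. 1) d)" for d
  proof (intro equalityI subsetI)
    fix y :: "(tw_var, 'k) mpoly" assume "y \<in> R_A_component n a d"
    then obtain p where p: "p \<in> carrier ?P" "y = \<phi> p" "y \<in> homogeneous deg_tw d"
      by (auto simp: comp)
    \<comment> \<open>The preimage \<open>p\<close> may be inhomogeneous. Its degree
      \<open>d\<close> component has the same image, since \<open>y\<close> is its own degree
      \<open>d\<close> component.\<close>
    then have "y = \<phi> (hcomp (\<lambda>_. 1) d p)"
      using hcomp_phi[of p d] hcomp_of_homogeneous[OF p(3), of d] by simp
    then show "y \<in> \<phi> ` (carrier ?P \<inter> homogeneous (\<lambda>_. 1) d)"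
      using hcomp_carrier[OF p(1)] hcomp_homogeneous by blast
  next
    fix y assume "y \<in> \<phi> ` (carrier ?P \<inter> homogeneous (\<lambda>_. 1) d)"
    then obtain p where p: "p \<in> carrier ?P" "y = \<phi> p" "p \<in> homogeneous (\<lambda>_. 1) d"
      by blast
    then have "y = hcomp deg_tw d y"
      using hcomp_phi[of p d] hcomp_of_homogeneous[OF p(3), of d] by simp
    then show "y \<in> R_A_component n a d"
      using p hcomp_homogeneous[of deg_tw d y] by (auto simp: comp)
  qed
  \<comment> \<open>By \<open>iso(4)\<close> the fibre over \<open>\<phi> p\<close> is the coset of
    \<open>p\<close>, so images of forms of degree \<open>d\<close> go to classes of forms of degree
    \<open>d\<close>.\<close>
  have g_comp: "g ` R_A_component n a d = coord_ring_component n I_A d" for d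
    unfolding component coord_ring_component_def image_image
    by (intro image_cong refl iso(4)) simp
  have "graded_algebra base_field (coord_ring n I_A) (coord_ring_component n I_A)"
    using graded_algebra_transport[OF graded g_hom g_bij g_zero] by (simp add: g_comp)
  then show ?thesis
    using ker graded g_hom g_bij g_comp unfolding graded_alg_isomorphic_def by blast
qed

end
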